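(* Let $(M,\mathcal T,I)$ be a triangulated connected closed surface with inversive distance $I\ge0$. Then the space $K(\Omega)=\{K(r): r\in\Omega\}$ of all possible discrete Gaussian curvatures is contained in the convex set $$\Big\{x\in\mathbb R^N\ \Big|\ \sum_{i\in V}x_i=2\pi\chi(M)\Big\}\cap\bigcap_{\emptyset\ne A\subsetneq V}Y_A,$$ where, for each nonempty proper subset $A\subset V$, $$Y_A=\Big\{x\in\mathbb R^N\ \Big|\ \sum_{i\in A}x_i>-\sum_{(e,v)\in Lk(A)}\big(\pi-\Lambda(I_e)\big)+2\pi\chi(F_A)\Big\}.$$
   Context: $M$ is a connected closed surface with triangulation $\mathcal T=\{V,E,F\}$ (vertices, edges, faces), $V=\{1,\dots,N\}$; $\{ij\}$ denotes the edge joining $i,j$ and $\{ijk\}$ the face with vertices $i,j,k$. The inversive distance is a fixed function $I:E\to[0,+\infty)$. For $r\in\mathbb R^N_{>0}$ put $l_{ij}=\sqrt{r_i^2+r_j^2+2r_ir_jI_{ij}}$ for each edge. $\Omega\subset\mathbb R^N_{>0}$ is the set of $r$ such that for every face $\{ijk\}$ the numbers $l_{ij},l_{jk},l_{ik}$ satisfy the three strict triangle inequalities. For $r\in\Omega$, $\theta_i^{jk}$ is the inner angle at $i$ of the Euclidean triangle with edge lengths $l_{ij},l_{jk},l_{ik}$, $K_i(r)=2\pi-\sum_{\{ijk\}\in F}\theta_i^{jk}$ (sum over faces containing $i$), and $K=(K_1,\dots,K_N)^T$. For a nonempty proper subset $A\subset V$: $F_A$ is the subcomplex of $\mathcal T$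 consisting of all simplices whose vertices all lie in $A$; $Lk(A)$ is the set of pairs $(e,v)$ of an edge $e$ and a vertex $v$ such that the end points of $e$ are not in $A$, $v\in A$, and $e$ and $v$ form a triangle (face) of $\mathcal T$. $\Lambda:\mathbb R\to[0,\pi]$ is given by $\Lambda(x)=\pi$ for $x\le-1$, $\Lambda(x)=\arccos x$ for $-1\le x\le1$, $\Lambda(x)=0$ for $x\ge1$. *)

theory Defs
  imports "HOL-Analysis.Analysis"
begin

text \<open>
  The vertex set \<open>V = {1,\<dots>,N}\<close> is a finite type \<open>'n\<close> with \<open>N = CARD('n)\<close>, so that
  radii and curvatures are vectors in \<open>real ^ 'n\<close>. A complex is the set of all its
  (nonempty) simplices, each given by its vertex set.
\<close>

definition closed_surface :: "'m topology \<Rightarrow> bool" where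
  "closed_surface M \<longleftrightarrow>
     Hausdorff_space M \<and> second_countable M \<and> compact_space M \<and>
     (\<forall>p \<in> topspace M. \<exists>U. openin M U \<and> p \<in> U \<and>
        subtopology M U homeomorphic_space (euclidean :: (real ^ 2) topology))"

definition simplicial_complex :: "'n set set \<Rightarrow> bool" where
  "simplicial_complex T \<longleftrightarrow>
     (\<forall>s \<in> T. finite s \<and> s \<noteq> {}) \<and> (\<forall>s \<in> T. \<forall>t. t \<noteq> {} \<and> t \<subseteq> s \<longrightarrow> t \<in> T)"

definition vertices :: "'n set set \<Rightarrow> 'n set" where
  "vertices T = {v. {v} \<in> T}"

definition edges :: "'n set set \<Rightarrow> 'n set set" where
  "edges T = {s \<in> T. card s = 2}"

definition faces :: "'n set set \<Rightarrow> 'n set set" where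
  "faces T = {s \<in> T. card s = 3}"

text \<open>Points of the geometric realization are given by their barycentric coordinates.\<close>

definition realization :: "'n::finite set set \<Rightarrow> (real ^ 'n) set" where
  "realization T =
     {x. (\<forall>i. 0 \<le> x $ i) \<and> (\<Sum>i\<in>UNIV. x $ i) = 1 \<and> {i. x $ i \<noteq> 0} \<in> T}"

definition triangulates :: "'n::finite set set \<Rightarrow> 'm topology \<Rightarrow> bool" where
  "triangulates T M \<longleftrightarrow>
     simplicial_complex T \<and> vertices T = UNIV \<and> (\<forall>s \<in> T. card s \<le> 3) \<and>
     top_of_set (realization T) homeomorphic_space M"

text \<open>
  Euler characteristic of a complex of dimension at most two. For a triangulation
  of a surface \<open>M\<close> it is the Euler characteristic of \<open>M\<close>.
\<close>

definition euler_char :: "'n set set \<Rightarrow> int" where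
  "euler_char T = int (card (vertices T)) - int (card (edges T)) + int (card (faces T))"

definition edge_length :: "('n set \<Rightarrow> real) \<Rightarrow> real ^ 'n \<Rightarrow> 'n \<Rightarrow> 'n \<Rightarrow> real" where
  "edge_length I r i j = sqrt ((r $ i)\<^sup>2 + (r $ j)\<^sup>2 + 2 * r $ i * r $ j * I {i, j})"

text \<open>Ranging over all orderings \<open>i, j, k\<close> of a face yields all three triangle inequalities.\<close>

definition Omega :: "'n set set \<Rightarrow> ('n set \<Rightarrow> real) \<Rightarrow> (real ^ 'n) set" where
  "Omega T I =
     {r. (\<forall>i. 0 < r $ i) \<and>
         (\<forall>i j k. {i, j, k} \<in> faces T \<longrightarrow>
            edge_length I r i k < edge_length I r i j + edge_length I r j k)}"

definition angle_at :: "real ^ 2 \<Rightarrow> real ^ 2 \<Rightarrow> real ^ 2 \<Rightarrow> real" where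
  "angle_at p q s = arccos (((q - p) \<bullet> (s - p)) / (norm (q - p) * norm (s - p)))"

text \<open>
  The inner angle enclosed by the sides of lengths \<open>a\<close> and \<open>b\<close> in a Euclidean triangle
  with side lengths \<open>a, b, c\<close>. It is unique because such a triangle is unique up to
  isometry, and it exists under the triangle inequalities.
\<close>

definition triangle_angle :: "real \<Rightarrow> real \<Rightarrow> real \<Rightarrow> real" where
  "triangle_angle a b c =
     (THE t. \<exists>p q s. dist p q = a \<and> dist p s = b \<and> dist q s = c \<and> t = angle_at p q s)"

definition theta :: "('n set \<Rightarrow> real) \<Rightarrow> real ^ 'n \<Rightarrow> 'n \<Rightarrow> 'n \<Rightarrow> 'n \<Rightarrow> real" where
  "theta I r i j k =
     triangle_angle (edge_length I r i j) (edge_length I r i k) (edge_length I r j k)"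

text \<open>
  The angle at the vertex \<open>i\<close> of the face \<open>f\<close>; well defined since \<open>theta\<close> is
  symmetric in its last two arguments.
\<close>

definition face_angle :: "('n set \<Rightarrow> real) \<Rightarrow> real ^ 'n \<Rightarrow> 'n \<Rightarrow> 'n set \<Rightarrow> real" where
  "face_angle I r i f = (THE t. \<exists>j k. f - {i} = {j, k} \<and> t = theta I r i j k)"

definition curvature ::
  "'n::finite set set \<Rightarrow> ('n set \<Rightarrow> real) \<Rightarrow> real ^ 'n \<Rightarrow> real ^ 'n" where
  "curvature T I r = (\<chi> i. 2 * pi - (\<Sum>f \<in> {f \<in> faces T. i \<in> f}. face_angle I r i f))"

definition induced_subcomplex :: "'n set set \<Rightarrow> 'n set \<Rightarrow> 'n set set" where
  "induced_subcomplex T A = {s \<in> T. s \<subseteq> A}"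

definition Lk :: "'n set set \<Rightarrow> 'n set \<Rightarrow> ('n set \<times> 'n) set" where
  "Lk T A = {(e, v). e \<in> edges T \<and> e \<inter> A = {} \<and> v \<in> A \<and> insert v e \<in> faces T}"

definition Lam :: "real \<Rightarrow> real" where
  "Lam x = (if x \<le> -1 then pi else if x \<le> 1 then arccos x else 0)"

definition Y :: "'n::finite set set \<Rightarrow> ('n set \<Rightarrow> real) \<Rightarrow> 'n set \<Rightarrow> (real ^ 'n) set" where
  "Y T I A =
     {x. (\<Sum>i\<in>A. x $ i) >
         - (\<Sum>(e, v) \<in> Lk T A. pi - Lam (I e))
         + 2 * pi * of_int (euler_char (induced_subcomplex T A))}"

end

theory Submission
  imports Defs
begin

text \<open>
  For a set \<open>A\<close> of vertices, the sum of the curvatures over \<open>A\<close> is \<open>2 * pi * card A\<close> minus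
  all angles at vertices in \<open>A\<close>. Grouped by faces, these angles are estimated by the number
  of vertices that a face has in \<open>A\<close>. Three angles of a triangle add up to \<open>pi\<close>, two of them
  to less than \<open>pi\<close>, and a single angle opposite to an edge \<open>e\<close> is less than \<open>pi - \<Lambda> (I e)\<close>
  (\<open>face_angle_less_opposite\<close>); the faces of the last kind are exactly the pairs in the link
  of \<open>A\<close>.

  Summing these bounds gives the right-hand side of the assertion because each edge lies in
  exactly two faces. Let \<open>F\<^sub>2\<close> and \<open>F\<^sub>3\<close> be the numbers of faces with two and with three
  vertices in \<open>A\<close>, and \<open>E\<close> the number of edges in \<open>A\<close>. Double counting yields
  \<open>2 * E = F\<^sub>2 + 3 * F\<^sub>3\<close>, whence \<open>pi * (F\<^sub>2 + F\<^sub>3) = 2 * pi * (E - F\<^sub>3)\<close>, and together with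
  \<open>2 * pi * card A\<close> this produces the Euler characteristic of the induced subcomplex
  (\<open>face_bound_sum\<close>). If \<open>A\<close> consists of all vertices, everything is an equality. If \<open>A\<close> is
  nonempty and proper, then connectedness supplies a face with one or two vertices in \<open>A\<close>
  (\<open>mixed_face_exists\<close>), and the estimate is strict.

  Each edge lies in exactly two faces (\<open>edge_in_exactly_two_faces\<close>) because the midpoint of
  the edge has a planar neighbourhood. With three faces, two of them would form a disc that is
  not a neighbourhood of the midpoint; with fewer than two faces, the surface would embed near
  the midpoint into a closed half plane with the midpoint on the boundary. Both contradict
  invariance of domain. Convexity is clear, as the set is an intersection of a hyperplane and
  open half spaces.
\<close>

section \<open>Simplicial complexes and planar charts\<close>

lemma simplicial_complex_subset:
  assumes "simplicial_complex T" "s \<in> T" "t \<noteq> {}" "t \<subseteq> s"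
  shows "t \<in> T"
proof -
  have "\<forall>t. t \<noteq> {} \<and> t \<subseteq> s \<longrightarrow> t \<in> T"
    using assms(1,2) unfolding simplicial_complex_def by (elim conjE bspec)
  thus ?thesis using assms(3,4) by blast
qed

text \<open>
  Invariance of domain, transported along a planar chart in both directions: out of the
  chart domain here, into it in the next lemma. These are the only topological tools that
  the count of the faces at an edge requires.
\<close>

lemma homeomorphism_planar_preserves_open_maps:
  fixes U :: "'a::topological_space set" and f :: "'a \<Rightarrow> real ^ 2"
  assumes hom: "homeomorphism U UNIV f g"
    and W: "openin (top_of_set U) W"
    and h: "continuous_on W h" "inj_on h W"
  shows "open (h ` W :: (real ^ 2) set)"
proof -
  have "openin (top_of_set UNIV) (f ` W)"
    using homeomorphism_imp_open_map[OF hom W] .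
  hence op: "open (f ` W)" by simp
  have WU: "W \<subseteq> U" using W openin_imp_subset by blast
  have gf: "\<And>x. x \<in> W \<Longrightarrow> g (f x) = x"
    using hom WU by (auto simp: homeomorphism_def)
  have img: "g ` f ` W = W" using gf by (force simp: image_image)
  have "continuous_on (f ` W) (h \<circ> g)"
    using hom h(1) img
    by (intro continuous_on_compose) (auto simp: homeomorphism_def intro: continuous_on_subset)
  moreover have "inj_on (h \<circ> g) (f ` W)"
    using gf h(2) by (auto simp: inj_on_def)
  ultimately have "open ((h \<circ> g) ` f ` W)"
    using op invariance_of_domain by blast
  moreover have "(h \<circ> g) ` f ` W = h ` W" using img image_comp[of h g "f ` W"] by (simp only:)
  ultimately show ?thesis by (simp only:)
qed

lemma injective_planar_image_openin:
  fixes U :: "'a::topological_space set" and f :: "'a \<Rightarrow> real ^ 2" and B :: "(real ^ 2) set"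
  assumes hom: "homeomorphism U UNIV f g"
    and B: "open B"
    and h: "continuous_on B h" "inj_on h B" "h ` B \<subseteq> U"
  shows "openin (top_of_set U) (h ` B)"
proof -
  have "continuous_on B (f \<circ> h)"
    using hom h by (intro continuous_on_compose) (auto simp: homeomorphism_def intro: continuous_on_subset)
  moreover have "inj_on (f \<circ> h) B"
  proof (rule comp_inj_on[OF h(2)])
    show "inj_on f (h ` B)"
      using homeomorphism_apply1[OF hom] h(3) by (metis inj_on_inverseI inj_on_subset)
  qed
  ultimately have "open ((f \<circ> h) ` B)"
    using B invariance_of_domain by blast
  hence "openin (top_of_set UNIV) ((f \<circ> h) ` B)" by simp
  hence "openin (top_of_set U) (g ` (f \<circ> h) ` B)"
    using homeomorphism_imp_open_map[OF homeomorphism_symD[OF hom]] by blast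
  moreover have "g ` (f \<circ> h) ` B = h ` B"
    unfolding image_image comp_apply
    by (rule image_cong[OF refl], rule homeomorphism_apply1[OF hom]) (use h(3) in blast)
  ultimately show ?thesis by simp
qed

lemma realization_chart:
  fixes T :: "'n::finite set set" and M :: "'m topology"
  assumes M: "closed_surface M" and T: "triangulates T M" and x: "x \<in> realization T"
  obtains U f g where "openin (top_of_set (realization T)) U" "x \<in> U"
    "homeomorphism U (UNIV :: (real ^ 2) set) f g"
proof -
  let ?R = "top_of_set (realization T)"
  obtain h where h: "homeomorphic_map ?R M h"
    using T unfolding triangulates_def homeomorphic_space by blast
  have "h x \<in> topspace M"
    using x homeomorphic_imp_surjective_map[OF h] by auto
  then obtain V where V: "openin M V" "h x \<in> V"
    "subtopology M V homeomorphic_space (euclidean :: (real ^ 2) topology)"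
    using M unfolding closed_surface_def by blast
  define U where "U = {y \<in> realization T. h y \<in> V}"
  have U: "openin ?R U"
    using openin_continuous_map_preimage[OF homeomorphic_imp_continuous_map[OF h] V(1)]
    by (simp add: U_def)
  have "homeomorphic_map (subtopology ?R U) (subtopology M V) h"
  proof (rule homeomorphic_map_subtopologies[OF h])
    show "h ` (topspace ?R \<inter> U) = topspace M \<inter> V"
      using homeomorphic_imp_surjective_map[OF h] by (auto simp: U_def)
  qed
  hence "subtopology ?R U homeomorphic_space (euclidean :: (real ^ 2) topology)"
    using V(3) homeomorphic_map_imp_homeomorphic_space homeomorphic_space_trans by blast
  \<comment> \<open>\<open>U\<close> was found inside the subspace topology of the realization; the chart is wanted
  for the subspace topology that \<open>U\<close> inherits from the whole coordinate space.\<close>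
  moreover have "subtopology ?R U = top_of_set U"
    using openin_imp_subset[OF U] by (simp add: subtopology_subtopology inf.absorb2)
  ultimately have "top_of_set U homeomorphic_space (euclidean :: (real ^ 2) topology)"
    by simp
  then obtain f g where "homeomorphic_maps (top_of_set U) (euclidean :: (real ^ 2) topology) f g"
    unfolding homeomorphic_space_def by blast
  hence "homeomorphism U UNIV f g"
    unfolding homeomorphic_maps_def homeomorphism_def
    by (auto simp: continuous_map_iff_continuous continuous_map_in_subtopology image_iff Pi_iff) metis+
  with U that show ?thesis using x V(2) by (auto simp: U_def)
qed

section \<open>Every edge lies in exactly two faces\<close>

text \<open>
  The first parameter moves along the common edge \<open>{i, j}\<close> of the triangles \<open>{i, j, k}\<close>
  and \<open>{i, j, l}\<close>, with the origin at its midpoint; the second one moves away from the edge,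
  towards \<open>k\<close> if it is positive and towards \<open>l\<close> if it is negative. So a planar box is
  folded along its middle line onto a neighbourhood of the midpoint in the union of the two
  triangles.
\<close>

definition two_face_disc :: "'n \<Rightarrow> 'n \<Rightarrow> 'n \<Rightarrow> 'n \<Rightarrow> real ^ 2 \<Rightarrow> real ^ 'n" where
  "two_face_disc i j k l z =
     (\<chi> v. if v = i then (1 - \<bar>z $ 2\<bar>) / 2 + z $ 1
           else if v = j then (1 - \<bar>z $ 2\<bar>) / 2 - z $ 1
           else if v = k then max (z $ 2) 0
           else if v = l then max (- (z $ 2)) 0 else 0)"

text \<open>
  On this box both barycentric coordinates belonging to the edge stay positive.
\<close>

definition parameter_box :: "(real ^ 2) set" where
  "parameter_box = {z. \<bar>z $ 1\<bar> < 1/4 \<and> \<bar>z $ 2\<bar> < 1/2}"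

lemma open_parameter_box: "open parameter_box"
  unfolding parameter_box_def
  by (intro open_Collect_conj open_Collect_less continuous_intros)

lemma zero_in_parameter_box: "0 \<in> parameter_box"
  by (simp add: parameter_box_def)

lemma continuous_on_if_const:
  assumes "continuous_on S f" "continuous_on S g"
  shows "continuous_on S (\<lambda>x. if P then f x else g x)"
  using assms by (cases P) simp_all

lemma continuous_on_two_face_disc: "continuous_on S (two_face_disc i j k l)"
  unfolding two_face_disc_def
  by (rule continuous_on_vec_lambda, intro continuous_on_if_const; intro continuous_intros; simp)

lemma two_face_disc_nth:
  assumes "distinct [i, j, k, l]"
  shows "two_face_disc i j k l z $ i = (1 - \<bar>z $ 2\<bar>) / 2 + z $ 1"
    and "two_face_disc i j k l z $ j = (1 - \<bar>z $ 2\<bar>) / 2 - z $ 1"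
    and "two_face_disc i j k l z $ k = max (z $ 2) 0"
    and "two_face_disc i j k l z $ l = max (- (z $ 2)) 0"
    and "v \<notin> {i, j, k, l} \<Longrightarrow> two_face_disc i j k l z $ v = 0"
  using assms by (auto simp: two_face_disc_def)

lemma inj_two_face_disc:
  assumes d: "distinct [i, j, k, l]"
  shows "inj (two_face_disc i j k l)"
proof (rule injI)
  fix z w assume eq: "two_face_disc i j k l z = two_face_disc i j k l w"
  have c: "two_face_disc i j k l z $ v = two_face_disc i j k l w $ v" for v
    by (simp only: eq)
  have "max (z $ 2) 0 = max (w $ 2) 0"
    using c[of k] unfolding two_face_disc_nth(3)[OF d] .
  moreover have "max (- (z $ 2)) 0 = max (- (w $ 2)) 0"
    using c[of l] unfolding two_face_disc_nth(4)[OF d] .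
  ultimately have "z $ 2 = w $ 2" by linarith
  moreover from this have "z $ 1 = w $ 1"
    using c[of i] unfolding two_face_disc_nth(1)[OF d] by simp
  ultimately show "z = w" by (simp add: vec_eq_iff forall_2)
qed

lemma two_face_disc_in_realization:
  fixes T :: "'n::finite set set"
  assumes T: "simplicial_complex T" and d: "distinct [i, j, k, l]"
    and f: "{i, j, k} \<in> T" "{i, j, l} \<in> T" and z: "z \<in> parameter_box"
  shows "two_face_disc i j k l z \<in> realization T"
proof -
  define y where "y = two_face_disc i j k l z"
  note y_nth = two_face_disc_nth[OF d, where z = z, folded y_def]
  have z12: "- (1/4) < z $ 1" "z $ 1 < 1/4" "\<bar>z $ 2\<bar> < 1/2"
    using z by (auto simp: parameter_box_def)
  have pos: "0 < y $ i" "0 < y $ j" using z12 by (simp_all add: y_nth(1,2) field_simps)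
  have nonneg: "0 \<le> y $ v" for v
  proof (cases "v \<in> {i, j, k, l}")
    case True
    thus ?thesis using pos y_nth(3,4) by fastforce
  qed (simp add: y_nth(5))
  have "(\<Sum>v\<in>UNIV. y $ v) = (\<Sum>v\<in>{i, j, k, l}. y $ v)"
    by (rule sum.mono_neutral_right) (simp_all add: y_nth(5))
  also have "\<dots> = y $ i + y $ j + y $ k + y $ l" using d by simp
  also have "\<dots> = 1" by (cases "0 \<le> z $ 2") (simp_all add: y_nth field_simps)
  finally have sum: "(\<Sum>v\<in>UNIV. y $ v) = 1" .
  have supp: "{v. y $ v \<noteq> 0} \<subseteq> {i, j, k, l}" using y_nth(5) by blast
  have "y $ l = 0 \<or> y $ k = 0" by (cases "0 \<le> z $ 2") (simp_all add: y_nth)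
  hence "{v. y $ v \<noteq> 0} \<subseteq> {i, j, k} \<or> {v. y $ v \<noteq> 0} \<subseteq> {i, j, l}"
    using supp by blast
  moreover have ne: "{v. y $ v \<noteq> 0} \<noteq> {}" using pos by force
  ultimately have "{v. y $ v \<noteq> 0} \<in> T"
    by (elim disjE; intro simplicial_complex_subset[OF T f(1) ne] simplicial_complex_subset[OF T f(2) ne])
  hence "y \<in> realization T" using nonneg sum by (simp add: realization_def)
  thus ?thesis by (simp only: y_def)
qed

text \<open>
  By invariance of domain the disc formed by the first two triangles is a neighbourhood of
  the midpoint of the edge in the whole realization. But points of the third triangle come
  arbitrarily close to the midpoint, and they have a positive coordinate at \<open>m\<close>, which
  vanishes on the disc.
\<close>

lemma edge_not_in_three_faces:
  fixes T :: "'n::finite set set" and M :: "'m topology"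
  assumes M: "closed_surface M" and tri: "triangulates T M"
    and d: "distinct [i, j, k, l, m]"
    and f: "{i, j, k} \<in> T" "{i, j, l} \<in> T" "{i, j, m} \<in> T"
  shows False
proof -
  let ?R = "realization T" and ?B = parameter_box
  let ?G = "two_face_disc i j k l" and ?H = "two_face_disc i j m l"
  have T: "simplicial_complex T" using tri by (simp add: triangulates_def)
  have G: "?G \<in> ?B \<rightarrow> ?R" and H: "?H \<in> ?B \<rightarrow> ?R"
    using two_face_disc_in_realization[OF T] d f by auto
  have GH0: "?H 0 = ?G 0" by (simp add: two_face_disc_def vec_eq_iff)
  have "?G 0 \<in> ?R" using G zero_in_parameter_box by blast
  from realization_chart[OF M tri this] obtain U p q
    where U: "openin (top_of_set ?R) U" and x: "?G 0 \<in> U"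
      and hom: "homeomorphism U (UNIV :: (real ^ 2) set) p q" by blast
  \<comment> \<open>The chart covers only a part of the disc, but one that contains the midpoint.\<close>
  define B where "B = ?B \<inter> ?G -` U"
  have "openin (top_of_set ?B) B"
    unfolding B_def using continuous_openin_preimage[OF continuous_on_two_face_disc G U] .
  hence B: "open B" using open_parameter_box openin_open_eq by blast
  have "inj_on ?G B" using inj_two_face_disc[of i j k l] d by (auto intro: inj_on_subset)
  hence "openin (top_of_set U) (?G ` B)"
    by (intro injective_planar_image_openin[OF hom B continuous_on_two_face_disc]) (auto simp: B_def)
  hence "openin (top_of_set ?R) (?G ` B)" using U openin_trans by blast
  \<comment> \<open>\<open>?H\<close> is the same fold with the third triangle in the place of the first, so it runs
  into the third triangle from the same midpoint.\<close>
  hence "openin (top_of_set ?B) (?B \<inter> ?H -` (?G ` B))"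
    by (intro continuous_openin_preimage[OF continuous_on_two_face_disc H])
  hence "open (?B \<inter> ?H -` (?G ` B))" using open_parameter_box openin_open_eq by blast
  moreover have "0 \<in> ?B \<inter> ?H -` (?G ` B)"
    using zero_in_parameter_box x GH0 by (auto simp: B_def)
  ultimately obtain e where e: "0 < e" "ball 0 e \<subseteq> ?B \<inter> ?H -` (?G ` B)"
    using openE by blast
  define w :: "real ^ 2" where "w = vector [0, e / 2]"
  have "norm w = e / 2" using e(1) by (simp add: w_def norm_vec_def L2_set_def sum_2)
  hence "w \<in> ball 0 e" using e(1) by simp
  then obtain z where "?H w = ?G z" using e(2) by blast
  hence "?H w $ m = ?G z $ m" by simp
  moreover have "?H w $ m = e / 2"
    using two_face_disc_nth(3)[of i j m l w] d e(1) by (auto simp: w_def)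
  moreover have "?G z $ m = 0"
    using two_face_disc_nth(5)[where z = z and v = m, of i j k l] d by auto
  ultimately show False using e(1) by simp
qed

text \<open>
  If all simplices around the edge lie in one triangle, then near the midpoint of the edge
  the surface is a half plane with the edge on its boundary line (or just a line segment,
  if the triangle is degenerate or missing). By invariance of domain, the image in the plane
  should be open, but it does not cross the boundary line.
\<close>

lemma edge_not_in_at_most_one_face:
  fixes T :: "'n::finite set set" and M :: "'m topology"
  assumes M: "closed_surface M" and tri: "triangulates T M"
    and ij: "i \<noteq> j" "{i, j} \<in> T"
    and only: "\<And>s. s \<in> T \<Longrightarrow> {i, j} \<subseteq> s \<Longrightarrow> s \<subseteq> {i, j, k}"
  shows False
proof -
  let ?R = "realization T"
  define x :: "real ^ 'n" where "x = (\<chi> v. if v \<in> {i, j} then 1 / 2 else 0)"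
  have x_nth: "x $ v = (if v \<in> {i, j} then 1 / 2 else 0)" for v
    by (simp only: x_def vec_lambda_beta)
  have "(\<Sum>v\<in>UNIV. x $ v) = (\<Sum>v\<in>{i, j}. x $ v)"
    by (rule sum.mono_neutral_right) (simp_all add: x_nth)
  also have "\<dots> = 1" using ij by (simp add: x_nth)
  finally have "(\<Sum>v\<in>UNIV. x $ v) = 1" .
  moreover have "{v. x $ v \<noteq> 0} = {i, j}" by (simp add: x_nth set_eq_iff)
  moreover have "0 \<le> x $ v" for v by (simp add: x_nth)
  ultimately have x: "x \<in> ?R" using ij(2) by (simp add: realization_def)
  obtain U p q where U: "openin (top_of_set ?R) U" "x \<in> U"
      and hom: "homeomorphism U (UNIV :: (real ^ 2) set) p q"
    using realization_chart[OF M tri x] by blast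
  \<comment> \<open>The second coordinate of \<open>P y\<close> is the weight of \<open>y\<close> off the edge, hence nonnegative.\<close>
  define P :: "real ^ 'n \<Rightarrow> real ^ 2" where
    "P y = (\<chi> c. if c = 1 then y $ i - y $ j else 1 - y $ i - y $ j)" for y
  define W where "W = U \<inter> {y. 0 < y $ i \<and> 0 < y $ j}"
  have "open {y :: real ^ 'n. 0 < y $ i \<and> 0 < y $ j}"
    by (intro open_Collect_conj open_Collect_less continuous_intros)
  hence W: "openin (top_of_set U) W" unfolding W_def by (simp add: openin_open_Int)
  have coord: "y $ v = (if v = i then y $ i else if v = j then y $ j
      else if v = k then 1 - y $ i - y $ j else 0)" if "y \<in> W" for y v
  proof -
    have yR: "y \<in> ?R" using that openin_imp_subset[OF U(1)] by (auto simp: W_def)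
    have y: "{i, j} \<subseteq> {v. y $ v \<noteq> 0}" using that by (auto simp: W_def)
    have supp: "{v. y $ v \<noteq> 0} \<subseteq> {i, j, k}"
      using yR only[OF _ y] by (simp add: realization_def)
    have "1 = (\<Sum>v\<in>UNIV. y $ v)" using yR by (simp add: realization_def)
    also have "\<dots> = (\<Sum>v\<in>{i, j, k}. y $ v)"
      using supp by (intro sum.mono_neutral_right) auto
    finally have "k \<noteq> i \<Longrightarrow> k \<noteq> j \<Longrightarrow> y $ k = 1 - y $ i - y $ j" using ij by simp
    moreover have "y $ v = 0" if "v \<notin> {i, j, k}" using supp that by blast
    ultimately show ?thesis by (cases "v \<in> {i, j, k}") auto
  qed
  have "inj_on P W"
  proof (rule inj_onI)
    fix y z assume yz: "y \<in> W" "z \<in> W" "P y = P z"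
    have "P y $ 1 = P z $ 1" "P y $ 2 = P z $ 2" using yz(3) by simp_all
    hence ij_eq: "y $ i = z $ i" "y $ j = z $ j" by (simp_all add: P_def)
    have "y $ v = z $ v" for v
      by (simp only: coord[OF yz(1), of v] coord[OF yz(2), of v] ij_eq)
    thus "y = z" by (simp add: vec_eq_iff)
  qed
  moreover have "continuous_on W P"
    unfolding P_def
    by (rule continuous_on_vec_lambda, rule continuous_on_if_const; intro continuous_intros)
  ultimately have "open (P ` W)"
    using homeomorphism_planar_preserves_open_maps[OF hom W] by blast
  moreover have "P x = 0" by (simp add: P_def x_nth vec_eq_iff)
  moreover have "x \<in> W" using U by (simp add: W_def x_nth)
  ultimately have "open (P ` W)" "0 \<in> P ` W" by (auto intro: rev_image_eqI)
  then obtain e where e: "0 < e" "ball 0 e \<subseteq> P ` W" using openE by blast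
  define w :: "real ^ 2" where "w = vector [0, - e / 2]"
  have "norm w = e / 2" using e(1) by (simp add: w_def norm_vec_def L2_set_def sum_2)
  hence "w \<in> ball 0 e" using e(1) by simp
  then obtain y where y: "y \<in> W" "P y = w" using e(2) by blast
  have yR: "y \<in> ?R" using y(1) openin_imp_subset[OF U(1)] by (auto simp: W_def)
  have "y $ i + y $ j = (\<Sum>v\<in>{i, j}. y $ v)" using ij by simp
  also have "\<dots> \<le> (\<Sum>v\<in>UNIV. y $ v)"
    using yR by (intro sum_mono2) (auto simp: realization_def)
  also have "\<dots> = 1" using yR by (simp add: realization_def)
  finally have "0 \<le> P y $ 2" by (simp add: P_def)
  thus False using y(2) e(1) by (simp add: w_def)
qed

lemma edge_in_exactly_two_faces:
  fixes T :: "'n::finite set set" and M :: "'m topology"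
  assumes M: "closed_surface M" and tri: "triangulates T M" and e: "e \<in> edges T"
  shows "card {f \<in> faces T. e \<subseteq> f} = 2"
proof (rule antisym)
  let ?F = "{f \<in> faces T. e \<subseteq> f}"
  obtain i j where eij: "e = {i, j}" and ij: "i \<noteq> j" and eT: "e \<in> T"
    using e by (auto simp: edges_def card_2_iff)
  have third: "\<exists>k. f = {i, j, k} \<and> k \<noteq> i \<and> k \<noteq> j" if "f \<in> ?F" for f
  proof -
    have c: "card f = 3" "e \<subseteq> f" using that by (auto simp: faces_def)
    hence "card (f - e) = 1" using ij by (simp add: card_Diff_subset eij)
    then obtain k where "f - e = {k}" by (auto simp: card_1_singleton_iff)
    thus ?thesis using c(2) eij by (intro exI[of _ k]) auto
  qed
  show "card ?F \<le> 2"
  proof (rule ccontr)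
    assume "\<not> card ?F \<le> 2"
    hence "3 \<le> card ?F" by simp
    then obtain F where F: "F \<subseteq> ?F" "card F = 3" using obtain_subset_with_card_n by metis
    then obtain f1 f2 f3 where fs: "F = {f1, f2, f3}" "f1 \<noteq> f2" "f1 \<noteq> f3" "f2 \<noteq> f3"
      by (auto simp: card_3_iff)
    have inF: "f1 \<in> ?F" "f2 \<in> ?F" "f3 \<in> ?F" using F(1) unfolding fs(1) by blast+
    obtain k where k: "f1 = {i, j, k}" "k \<noteq> i" "k \<noteq> j" using third[OF inF(1)] by blast
    obtain l where l: "f2 = {i, j, l}" "l \<noteq> i" "l \<noteq> j" using third[OF inF(2)] by blast
    obtain m where m: "f3 = {i, j, m}" "m \<noteq> i" "m \<noteq> j" using third[OF inF(3)] by blast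
    have "k \<noteq> l" "k \<noteq> m" "l \<noteq> m" using fs(2-4) unfolding k(1) l(1) m(1) by blast+
    hence "distinct [i, j, k, l, m]" using ij k(2,3) l(2,3) m(2,3) by simp
    moreover have "{i, j, k} \<in> T" "{i, j, l} \<in> T" "{i, j, m} \<in> T"
      using inF unfolding k(1) l(1) m(1) by (simp_all add: faces_def)
    ultimately show False by (rule edge_not_in_three_faces[OF M tri])
  qed
  show "2 \<le> card ?F"
  proof (rule ccontr)
    assume "\<not> 2 \<le> card ?F"
    hence "card ?F \<le> 1" by simp
    hence one: "f = g" if "f \<in> ?F" "g \<in> ?F" for f g
      using that card_le_Suc0_iff_eq[of ?F] by (simp only: finite One_nat_def)
    have "\<exists>k. \<forall>f \<in> ?F. f = {i, j, k}"
    proof (cases "?F = {}")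
      case False
      then obtain f where f: "f \<in> ?F" by blast
      then obtain k where "f = {i, j, k}" using third by blast
      thus ?thesis using one[OF _ f] by blast
    qed blast
    then obtain k where k: "\<And>f. f \<in> ?F \<Longrightarrow> f = {i, j, k}" by blast
    have only: "s \<subseteq> {i, j, k}" if "s \<in> T" "{i, j} \<subseteq> s" for s
    proof -
      have "card s \<le> 3" using tri that(1) by (simp add: triangulates_def)
      moreover have "2 \<le> card s" using card_mono[OF finite that(2)] ij by simp
      ultimately consider "card s = 3" | "card s = card {i, j}" using ij by force
      thus ?thesis
      proof cases
        case 1
        thus ?thesis using k[of s] that eij by (simp add: faces_def)
      next
        case 2
        hence "s = {i, j}" using card_subset_eq[OF finite that(2)] by simp
        thus ?thesis by blast
      qed
    qed
    show False using edge_not_in_at_most_one_face[OF M tri ij, of k] eT eij only by blast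
  qed
qed

section \<open>Connectedness\<close>

text \<open>
  If no simplex had vertices both in \<open>A\<close> and outside, then the total weight on \<open>A\<close> would
  be a continuous function on the realization with values \<open>0\<close> and \<open>1\<close> only, and it takes
  both values, at vertices outside and inside \<open>A\<close>.
\<close>

lemma mixed_simplex_exists:
  fixes T :: "'n::finite set set" and M :: "'m topology"
  assumes "connected_space M" and tri: "triangulates T M"
    and A: "A \<noteq> {}" "A \<noteq> UNIV"
  obtains s where "s \<in> T" "s \<inter> A \<noteq> {}" "s - A \<noteq> {}"
proof -
  let ?R = "realization T"
  have False if no: "\<And>s. s \<in> T \<Longrightarrow> s \<subseteq> A \<or> s \<inter> A = {}"
  proof -
    define m :: "real ^ 'n \<Rightarrow> real" where "m y = (\<Sum>v\<in>A. y $ v)" for y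
    have "connected_space (top_of_set ?R)"
      using assms(1) tri homeomorphic_connected_space by (auto simp: triangulates_def)
    hence conn: "connected ?R" by (simp add: connectedin_def flip: connectedin_iff_connected)
    have "continuous_on ?R m" unfolding m_def by (intro continuous_intros)
    hence conn_m: "connected (m ` ?R)" using conn connected_continuous_image by blast
    have vert: "axis v 1 \<in> ?R" for v :: 'n
    proof -
      have "{u. axis v (1::real) $ u \<noteq> 0} = {v}" by (auto simp: axis_def)
      moreover have "(\<Sum>u\<in>UNIV. axis v (1::real) $ u) = 1" by (simp add: axis_def)
      moreover have "{v} \<in> T" using tri by (auto simp: triangulates_def vertices_def)
      ultimately show ?thesis by (simp add: realization_def axis_def)
    qed
    have m_axis: "m (axis v 1) = (if v \<in> A then 1 else 0)" for v
      by (simp add: m_def axis_def)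
    obtain a b where ab: "a \<in> A" "b \<notin> A" using A by blast
    have "0 \<in> m ` ?R" "1 \<in> m ` ?R"
      using m_axis vert ab by (metis imageI)+
    hence "1 / 2 \<in> m ` ?R" 
      using connectedD_interval[OF conn_m, of 0 1 "1/2"] by simp
    then obtain y where y: "y \<in> ?R" "m y = 1 / 2" by auto
    let ?s = "{v. y $ v \<noteq> 0}"
    have "?s \<in> T" using y(1) by (simp add: realization_def)
    hence "?s \<subseteq> A \<or> ?s \<inter> A = {}" by (rule no)
    moreover have "m y = 1" if "?s \<subseteq> A"
    proof -
      have "m y = (\<Sum>v\<in>UNIV. y $ v)"
        unfolding m_def using that by (intro sum.mono_neutral_left) auto
      thus ?thesis using y(1) by (simp add: realization_def)
    qed
    moreover have "m y = 0" if "?s \<inter> A = {}"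
      unfolding m_def using that by (intro sum.neutral) auto
    ultimately show False using y(2) by auto
  qed
  thus ?thesis using that by blast
qed

text \<open>
  A mixed simplex has a mixed edge, and this edge lies in a face. Such a face makes the
  estimate of the curvature strict.
\<close>

lemma mixed_face_exists:
  fixes T :: "'n::finite set set" and M :: "'m topology"
  assumes M: "closed_surface M" "connected_space M" and tri: "triangulates T M"
    and A: "A \<noteq> {}" "A \<noteq> UNIV"
  obtains f where "f \<in> faces T" "card (f \<inter> A) \<in> {1, 2}"
proof -
  have T: "simplicial_complex T" using tri by (simp add: triangulates_def)
  obtain s where s: "s \<in> T" "s \<inter> A \<noteq> {}" "s - A \<noteq> {}"
    using mixed_simplex_exists[OF M(2) tri A] by blast
  then obtain a b where ab: "a \<in> s" "a \<in> A" "b \<in> s" "b \<notin> A" by blast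
  have "{a, b} \<in> T" using simplicial_complex_subset[OF T s(1), of "{a, b}"] ab by simp
  moreover have "card {a, b} = 2" using ab by (metis card_2_iff)
  ultimately have "card {f \<in> faces T. {a, b} \<subseteq> f} = 2"
    by (intro edge_in_exactly_two_faces[OF M(1) tri]) (simp add: edges_def)
  hence "{f \<in> faces T. {a, b} \<subseteq> f} \<noteq> {}" by (metis card.empty zero_neq_numeral)
  then obtain f where f: "f \<in> faces T" "a \<in> f" "b \<in> f" by blast
  have "f \<inter> A \<noteq> {}" "f - A \<noteq> {}" using f ab by blast+
  hence "0 < card (f \<inter> A)" "0 < card (f - A)" by (simp_all add: card_gt_0_iff)
  moreover have "card (f \<inter> A) + card (f - A) = 3"
    using f(1) card_Int_Diff[of f A] by (simp add: faces_def)
  ultimately have "card (f \<inter> A) = 1 \<or> card (f \<inter> A) = 2" by linarith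
  thus ?thesis using that f(1) by simp
qed

section \<open>Angles of Euclidean triangles\<close>

lemma heron_identity:
  fixes a b c :: real
  shows "(2 * a * b)\<^sup>2 - (a\<^sup>2 + b\<^sup>2 - c\<^sup>2)\<^sup>2 = (a + b + c) * (a + b - c) * (b + c - a) * (c + a - b)"
  by (simp add: power2_eq_square algebra_simps)

text \<open>
  The law of cosines, as a formula for the angle between the sides \<open>a\<close> and \<open>b\<close>.
\<close>

definition angle_of_sides :: "real \<Rightarrow> real \<Rightarrow> real \<Rightarrow> real" where
  "angle_of_sides a b c = arccos ((a\<^sup>2 + b\<^sup>2 - c\<^sup>2) / (2 * a * b))"

text \<open>
  \<open>D\<close> is sixteen times the square of the area by Heron's formula. It is symmetric in the
  sides, so the three sines share one numerator; the proof of the angle sum rests on that.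
\<close>

lemma angle_of_sides_cos_sin:
  fixes a b c :: real
  assumes "a < b + c" "b < c + a" "c < a + b"
  defines "D \<equiv> (a + b + c) * (a + b - c) * (b + c - a) * (c + a - b)"
  shows "0 < a" "0 < b" "0 < D"
    and "cos (angle_of_sides a b c) = (a\<^sup>2 + b\<^sup>2 - c\<^sup>2) / (2 * a * b)"
    and "sin (angle_of_sides a b c) = sqrt D / (2 * a * b)"
    and "0 < angle_of_sides a b c" "angle_of_sides a b c < pi"
proof -
  show a: "0 < a" and b: "0 < b" using assms by linarith+
  show D: "0 < D" unfolding D_def using assms by (intro mult_pos_pos) linarith+
  let ?x = "(a\<^sup>2 + b\<^sup>2 - c\<^sup>2) / (2 * a * b)"
  have id: "1 - ?x\<^sup>2 = D / (2 * a * b)\<^sup>2"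
    unfolding D_def heron_identity[symmetric] using a b by (simp add: field_simps)
  have "0 < D / (2 * a * b)\<^sup>2" using a b D by simp
  hence "?x\<^sup>2 < 1\<^sup>2" using id by simp
  hence x: "-1 < ?x" "?x < 1" by (metis abs_square_less_1 abs_less_iff minus_less_iff one_power2)+
  show "cos (angle_of_sides a b c) = ?x"
    unfolding angle_of_sides_def using x by (simp add: cos_arccos)
  show "0 < angle_of_sides a b c" "angle_of_sides a b c < pi"
    unfolding angle_of_sides_def using arccos_lt_bounded[OF x] by auto
  have "sin (arccos ?x) = sqrt (1 - ?x\<^sup>2)" using x by (intro sin_arccos) auto
  thus "sin (angle_of_sides a b c) = sqrt D / (2 * a * b)"
    unfolding angle_of_sides_def id using a b by (simp add: real_sqrt_divide)
qed

lemma angle_of_sides_commute: "angle_of_sides a b c = angle_of_sides b a c"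
  by (simp add: angle_of_sides_def ac_simps)

text \<open>
  The addition theorem shows that the sum of two angles has the same sine and the opposite
  cosine as the third one. Since the sine is positive, that sum lies below \<open>pi\<close>, where it is
  determined by its cosine.
\<close>

lemma angle_of_sides_sum:
  fixes a b c :: real
  assumes "a < b + c" "b < c + a" "c < a + b"
  shows "angle_of_sides a b c + angle_of_sides b c a + angle_of_sides c a b = pi"
proof -
  define D where "D = (a + b + c) * (a + b - c) * (b + c - a) * (c + a - b)"
  define p q s where "p = angle_of_sides a b c" and "q = angle_of_sides b c a"
    and "s = angle_of_sides c a b"
  have Ds: "(b + c + a) * (b + c - a) * (c + a - b) * (a + b - c) = D"
    "(c + a + b) * (c + a - b) * (a + b - c) * (b + c - a) = D"
    by (simp_all add: D_def algebra_simps)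
  note P = angle_of_sides_cos_sin[OF assms, folded D_def p_def]
  note Q = angle_of_sides_cos_sin[OF assms(2,3,1), unfolded Ds, folded q_def]
  note S = angle_of_sides_cos_sin[OF assms(3,1,2), unfolded Ds, folded s_def]
  have pos: "a > 0" "b > 0" "c > 0" using P Q by auto
  have D2: "sqrt D * sqrt D = D" using P(3) by simp
  have "sin (p + q) = sin s"
    unfolding sin_add P Q S using pos by (simp add: field_simps power2_eq_square)
  moreover have "0 < sin s" using S by (intro sin_gt_zero)
  ultimately have "0 < sin (p + q)" by simp
  moreover have "sin (p + q) \<le> 0" if "pi \<le> p + q"
  proof -
    have "0 \<le> sin (p + q - pi)" using that P(7) Q(7) by (intro sin_ge_zero) auto
    thus ?thesis by (simp add: sin_diff)
  qed
  ultimately have pq: "p + q \<le> pi" by (smt (verit))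
  have "cos (p + q) = (((a\<^sup>2 + b\<^sup>2 - c\<^sup>2) * (b\<^sup>2 + c\<^sup>2 - a\<^sup>2)) - D) / (4 * a * b * b * c)"
    unfolding cos_add P Q using pos D2 by (simp add: field_simps)
  also have "\<dots> = - ((c\<^sup>2 + a\<^sup>2 - b\<^sup>2) / (2 * c * a))"
    unfolding D_def using pos by (simp add: divide_simps) (simp add: power2_eq_square algebra_simps)
  also have "\<dots> = cos (pi - s)" unfolding S(4)[symmetric] by (simp add: cos_diff)
  finally have "cos (p + q) = cos (pi - s)" .
  hence "p + q = pi - s"
    using cos_inj_pi[of "p + q" "pi - s"] P(6) Q(6) S(6,7) pq by simp
  thus ?thesis by (simp add: p_def q_def s_def)
qed

lemma triangle_angle_eq:
  assumes "a < b + c" "b < c + a" "c < a + b"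
  shows "triangle_angle a b c = angle_of_sides a b c"
  unfolding triangle_angle_def
proof (rule the_equality)
  let ?t = "angle_of_sides a b c"
  note A = angle_of_sides_cos_sin[OF assms]
  have uniq: "angle_at p q s = ?t" if "dist p q = a" "dist p s = b" "dist q s = c" for p q s
  proof -
    have n: "norm (q - p) = a" "norm (s - p) = b" "norm ((q - p) - (s - p)) = c"
      using that by (simp_all add: dist_norm norm_minus_commute)
    have ip: "(q - p) \<bullet> (s - p) = (a\<^sup>2 + b\<^sup>2 - c\<^sup>2) / 2"
      unfolding n[symmetric] power2_norm_eq_inner by (simp add: inner_diff inner_commute)
    show ?thesis unfolding angle_at_def angle_of_sides_def n ip by (simp add: mult.assoc)
  qed
  define q :: "real ^ 2" where "q = vector [a, 0]"
  define s :: "real ^ 2" where "s = vector [b * cos ?t, b * sin ?t]"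
  have "dist 0 q = a" using A by (simp add: q_def norm_vec_def L2_set_def sum_2)
  moreover have "dist 0 s = b"
  proof -
    have "(b * cos ?t)\<^sup>2 + (b * sin ?t)\<^sup>2 = b\<^sup>2 * ((sin ?t)\<^sup>2 + (cos ?t)\<^sup>2)"
      by (simp only: power_mult_distrib distrib_left add.commute)
    hence "sqrt ((b * cos ?t)\<^sup>2 + (b * sin ?t)\<^sup>2) = b" using A(2) by simp
    thus ?thesis by (simp add: s_def norm_vec_def L2_set_def sum_2)
  qed
  moreover have "dist q s = c"
  proof -
    have "(a - b * cos ?t)\<^sup>2 + (b * sin ?t)\<^sup>2 = a\<^sup>2 + b\<^sup>2 * ((sin ?t)\<^sup>2 + (cos ?t)\<^sup>2) - 2 * a * b * cos ?t"
      by (simp only: power2_diff power_mult_distrib distrib_left algebra_simps)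
    also have "\<dots> = a\<^sup>2 + b\<^sup>2 - 2 * a * b * cos ?t" by simp
    also have "\<dots> = c\<^sup>2" unfolding A(4) using A(1,2) by simp
    finally have "(a - b * cos ?t)\<^sup>2 + (b * sin ?t)\<^sup>2 = c\<^sup>2" .
    moreover have "0 \<le> c" using assms by linarith
    ultimately have "sqrt ((a - b * cos ?t)\<^sup>2 + (b * sin ?t)\<^sup>2) = c" by simp
    thus ?thesis by (simp add: q_def s_def dist_norm norm_vec_def L2_set_def sum_2)
  qed
  ultimately show "\<exists>p q s. dist p q = a \<and> dist p s = b \<and> dist q s = c \<and> ?t = angle_at p q s"
    using uniq by metis
  show "\<And>t. \<exists>p q s. dist p q = a \<and> dist p s = b \<and> dist q s = c \<and> t = angle_at p q s \<Longrightarrow> t = ?t"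
    using uniq by blast
qed

section \<open>Angles of the faces\<close>

lemma edge_length_commute: "edge_length I r i j = edge_length I r j i"
  by (simp add: edge_length_def insert_commute ac_simps)

lemma edge_length_power2:
  assumes "0 < r $ i" "0 < r $ j" "0 \<le> I {i, j}"
  shows "(edge_length I r i j)\<^sup>2 = (r $ i)\<^sup>2 + (r $ j)\<^sup>2 + 2 * r $ i * r $ j * I {i, j}"
  unfolding edge_length_def using assms by (intro real_sqrt_pow2) auto

lemma edge_length_gt_radius:
  assumes "0 < r $ i" "0 < r $ j" "0 \<le> I {i, j}"
  shows "r $ j < edge_length I r i j"
  unfolding edge_length_def
proof (rule real_less_rsqrt)
  have "0 \<le> 2 * r $ i * r $ j * I {i, j}" using assms by simp
  thus "(r $ j)\<^sup>2 < (r $ i)\<^sup>2 + (r $ j)\<^sup>2 + 2 * r $ i * r $ j * I {i, j}"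
    using assms(1) by (smt (verit) zero_less_power)
qed

lemma Omega_triangle_inequalities:
  assumes r: "r \<in> Omega T I" and f: "{i, j, k} \<in> faces T"
  defines "a \<equiv> edge_length I r i j" and "b \<equiv> edge_length I r i k" and "c \<equiv> edge_length I r j k"
  shows "a < b + c" "b < c + a" "c < a + b"
proof -
  have *: "edge_length I r x z < edge_length I r x y + edge_length I r y z"
    if "{x, y, z} = {i, j, k}" for x y z
    using r f that unfolding Omega_def by force
  show "a < b + c" using *[of i k j] unfolding a_def b_def c_def
    by (auto simp: edge_length_commute[of I r k j])
  show "b < c + a" using *[of i j k] unfolding a_def b_def c_def by auto
  show "c < a + b" using *[of j i k] unfolding a_def b_def c_def
    by (auto simp: edge_length_commute[of I r j i])
qed

lemma face_angle_eq:
  assumes r: "r \<in> Omega T I" and f: "{i, j, k} \<in> faces T" and d: "distinct [i, j, k]"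
  shows "face_angle I r i {i, j, k} =
    angle_of_sides (edge_length I r i j) (edge_length I r i k) (edge_length I r j k)"
proof -
  have th: "theta I r i x y =
      angle_of_sides (edge_length I r i x) (edge_length I r i y) (edge_length I r x y)"
    if "{i, x, y} = {i, j, k}" for x y
    unfolding theta_def
    by (rule triangle_angle_eq; rule Omega_triangle_inequalities[OF r]) (use f that in simp_all)
  have sym: "theta I r i k j = theta I r i j k"
    using th[of j k] th[of k j]
    by (simp add: insert_commute edge_length_commute[of I r k j] angle_of_sides_commute)
  have "face_angle I r i {i, j, k} = theta I r i j k"
    unfolding face_angle_def
  proof (rule the_equality)
    show "\<exists>x y. {i, j, k} - {i} = {x, y} \<and> theta I r i j k = theta I r i x y"
      using d by (intro exI[of _ j] exI[of _ k]) auto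
  next
    fix t assume "\<exists>x y. {i, j, k} - {i} = {x, y} \<and> t = theta I r i x y"
    then obtain x y where xy: "{i, j, k} - {i} = {x, y}" "t = theta I r i x y" by blast
    have "{i, j, k} - {i} = {j, k}" using d by auto
    hence "x = j \<and> y = k \<or> x = k \<and> y = j" using xy(1) by (simp add: doubleton_eq_iff)
    thus "t = theta I r i j k" using xy(2) sym by auto
  qed
  thus ?thesis using th[of j k] by simp
qed

lemma face_angle_bounds:
  assumes r: "r \<in> Omega T I" and f: "{i, j, k} \<in> faces T" and d: "distinct [i, j, k]"
  shows "0 < face_angle I r i {i, j, k}" "face_angle I r i {i, j, k} < pi"
  unfolding face_angle_eq[OF assms]
  using angle_of_sides_cos_sin(6,7)[OF Omega_triangle_inequalities[OF r f]] by auto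

lemma face_angles_sum:
  assumes r: "r \<in> Omega T I" and f: "{i, j, k} \<in> faces T" and d: "distinct [i, j, k]"
  shows "face_angle I r i {i, j, k} + face_angle I r j {i, j, k} + face_angle I r k {i, j, k} = pi"
proof -
  define a b c where "a = edge_length I r i j" and "b = edge_length I r i k"
    and "c = edge_length I r j k"
  have perm: "{j, i, k} = {i, j, k}" "{k, i, j} = {i, j, k}" by auto
  have "face_angle I r i {i, j, k} = angle_of_sides a b c"
    using face_angle_eq[OF assms] by (simp add: a_def b_def c_def)
  moreover have "face_angle I r j {i, j, k} = angle_of_sides c a b"
    using face_angle_eq[OF r, of j i k] f d unfolding perm
    by (auto simp: a_def b_def c_def edge_length_commute[of I r j i] angle_of_sides_commute)
  moreover have "face_angle I r k {i, j, k} = angle_of_sides b c a"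
    using face_angle_eq[OF r, of k i j] f d unfolding perm
    by (auto simp: a_def b_def c_def edge_length_commute[of I r k])
  ultimately show ?thesis
    using angle_of_sides_sum[OF Omega_triangle_inequalities[OF r f], folded a_def b_def c_def]
    by simp
qed

text \<open>
  Here nonnegativity of the inversive distance is decisive: each side at \<open>i\<close> is longer
  than the radius at its other end. With \<open>x = I {j, k}\<close>, expanding the squared side lengths
  shows that the numerator in the law of cosines exceeds \<open>- 2 r\<^sub>j r\<^sub>k x\<close>, which is at least
  \<open>- 2 a b x\<close>. So the cosine of the angle exceeds \<open>- x = cos (pi - arccos x)\<close>. For \<open>x \<ge> 1\<close>
  the bound is \<open>pi\<close>.
\<close>

lemma face_angle_less_opposite:
  assumes r: "r \<in> Omega T I" and f: "{i, j, k} \<in> faces T" and d: "distinct [i, j, k]"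
    and I: "0 \<le> I {i, j}" "0 \<le> I {i, k}" "0 \<le> I {j, k}"
  shows "face_angle I r i {i, j, k} < pi - Lam (I {j, k})"
proof (cases "I {j, k} < 1")
  case False
  hence "Lam (I {j, k}) = 0" by (simp add: Lam_def)
  thus ?thesis using face_angle_bounds[OF assms(1-3)] by simp
next
  case True
  define a b c x where "a = edge_length I r i j" and "b = edge_length I r i k"
    and "c = edge_length I r j k" and "x = I {j, k}"
  have pos: "0 < r $ v" for v using r by (simp add: Omega_def)
  note A = angle_of_sides_cos_sin[OF Omega_triangle_inequalities[OF r f], folded a_def b_def c_def]
  have x: "0 \<le> x" "x < 1" using I True by (auto simp: x_def)
  have "r $ j < a" "r $ k < b"
    using edge_length_gt_radius[of r i j I] edge_length_gt_radius[of r i k I] pos I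
    by (simp_all add: a_def b_def)
  hence "r $ j * r $ k \<le> a * b"
    using A(1,2) pos[of k] by (intro mult_mono) (simp_all add: less_imp_le)
  hence "x * (r $ j * r $ k) \<le> x * (a * b)" using x by (intro mult_left_mono)
  moreover have "0 < (r $ i)\<^sup>2" "0 \<le> r $ i * r $ j * I {i, j}" "0 \<le> r $ i * r $ k * I {i, k}"
    using pos[of i] pos[of j] pos[of k] I by auto
  moreover have "a\<^sup>2 + b\<^sup>2 - c\<^sup>2 = 2 * (r $ i)\<^sup>2 + 2 * (r $ i * r $ j * I {i, j})
      + 2 * (r $ i * r $ k * I {i, k}) - 2 * (x * (r $ j * r $ k))"
    unfolding a_def b_def c_def x_def using pos I by (simp add: edge_length_power2)
  ultimately have "- 2 * (x * (a * b)) < a\<^sup>2 + b\<^sup>2 - c\<^sup>2" by linarith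
  hence "- x * (2 * a * b) < a\<^sup>2 + b\<^sup>2 - c\<^sup>2" by (simp add: ac_simps)
  hence lt: "- x < (a\<^sup>2 + b\<^sup>2 - c\<^sup>2) / (2 * a * b)"
    using A(1,2) by (simp add: pos_less_divide_eq)
  have "(a\<^sup>2 + b\<^sup>2 - c\<^sup>2) / (2 * a * b) \<le> 1"
    using A(4) cos_le_one by metis
  hence "angle_of_sides a b c < arccos (- x)"
    unfolding angle_of_sides_def using lt x by (intro arccos_less_arccos) auto
  also have "\<dots> = pi - Lam x" using x by (simp add: arccos_minus Lam_def)
  finally show ?thesis
    using face_angle_eq[OF assms(1-3)] by (simp add: a_def b_def c_def x_def)
qed

section \<open>Summation over the faces\<close>

text \<open>
  This is \<open>0\<close>, \<open>pi - \<Lambda>\<close>, \<open>pi\<close> or \<open>pi\<close> if the face has 0, 1, 2 or 3 vertices in \<open>A\<close>. It is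
  written by means of a binomial coefficient, the number of edges of the face that lie
  in \<open>A\<close>, because in this form the three summands add up, over all faces, to the numbers of
  edges and faces of the induced subcomplex and to the sum over the link.
\<close>

definition face_bound :: "('n set \<Rightarrow> real) \<Rightarrow> 'n set \<Rightarrow> 'n set \<Rightarrow> real" where
  "face_bound I A f =
     pi * real (card (f \<inter> A) choose 2)
     - 2 * pi * (if card (f \<inter> A) = 3 then 1 else 0)
     + (if card (f \<inter> A) = 1 then pi - Lam (I (f - A)) else 0)"

lemma face_angle_sum_le_face_bound:
  fixes T :: "'n::finite set set" and A :: "'n set"
  assumes T: "simplicial_complex T" and r: "r \<in> Omega T I" and f: "f \<in> faces T"
    and I: "\<forall>e \<in> edges T. 0 \<le> I e"
  shows "(\<Sum>i \<in> f \<inter> A. face_angle I r i f) \<le> face_bound I A f"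
    and "card (f \<inter> A) \<in> {1, 2} \<Longrightarrow> (\<Sum>i \<in> f \<inter> A. face_angle I r i f) < face_bound I A f"
    and "card (f \<inter> A) = 3 \<Longrightarrow> (\<Sum>i \<in> f \<inter> A. face_angle I r i f) = face_bound I A f"
proof -
  define S where "S = (\<Sum>i \<in> f \<inter> A. face_angle I r i f)"
  have c3: "card f = 3" and fT: "f \<in> T" using f by (auto simp: faces_def)
  have Ie: "0 \<le> I {u, v}" if "u \<in> f" "v \<in> f" "u \<noteq> v" for u v
  proof -
    have "{u, v} \<in> T" using simplicial_complex_subset[OF T fT] that by simp
    thus ?thesis using I that(3) by (simp add: edges_def)
  qed
  have part: "card (f \<inter> A) + card (f - A) = 3" using c3 card_Int_Diff[of f A] by simp
  have one: "S < face_bound I A f" if 1: "card (f \<inter> A) = 1"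
  proof -
    obtain i where i: "f \<inter> A = {i}" using 1 by (auto simp: card_1_singleton_iff)
    have "card (f - A) = 2" using part 1 by simp
    then obtain j k where jk: "f - A = {j, k}" "j \<noteq> k" by (auto simp: card_2_iff)
    have fe: "f = {i, j, k}" using i jk by blast
    have d: "distinct [i, j, k]" using i jk by auto
    have "face_angle I r i f < pi - Lam (I (f - A))"
      unfolding jk(1) using face_angle_less_opposite[OF r f[unfolded fe] d] Ie d unfolding fe
      by simp
    thus ?thesis using 1 by (simp add: S_def face_bound_def i binomial_eq_0)
  qed
  have two: "S < face_bound I A f" if 2: "card (f \<inter> A) = 2"
  proof -
    obtain i j where i: "f \<inter> A = {i, j}" "i \<noteq> j" using 2 by (auto simp: card_2_iff)
    have "card (f - A) = 1" using part 2 by simp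
    then obtain k where k: "f - A = {k}" by (auto simp: card_1_singleton_iff)
    have fe: "f = {k, i, j}" using i k by blast
    have d: "distinct [k, i, j]" using i k by auto
    have "S < pi"
      unfolding S_def i(1)
      using face_angles_sum[OF r f[unfolded fe] d] face_angle_bounds(1)[OF r f[unfolded fe] d] i(2)
      unfolding fe by simp
    thus ?thesis using 2 by (simp add: face_bound_def)
  qed
  have three: "S = face_bound I A f" if 3: "card (f \<inter> A) = 3"
  proof -
    have fA: "f \<inter> A = f" using 3 c3 by (intro card_subset_eq) auto
    obtain i j k where fe: "f = {i, j, k}" and d: "distinct [i, j, k]"
      using c3 by (auto simp: card_3_iff)
    have "S = pi"
      unfolding S_def fA using face_angles_sum[OF r f[unfolded fe] d] d unfolding fe by simp
    thus ?thesis using 3 by (simp add: face_bound_def numeral_3_eq_3 numeral_2_eq_2)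
  qed
  have zero: "S = face_bound I A f" if 0: "card (f \<inter> A) = 0"
  proof -
    have "f \<inter> A = {}" using 0 by simp
    thus ?thesis by (simp add: S_def face_bound_def)
  qed
  show "(\<Sum>i \<in> f \<inter> A. face_angle I r i f) < face_bound I A f" if "card (f \<inter> A) \<in> {1, 2}"
    using one two that unfolding S_def by auto
  show "(\<Sum>i \<in> f \<inter> A. face_angle I r i f) = face_bound I A f" if "card (f \<inter> A) = 3"
    using three that unfolding S_def by auto
  have "card (f \<inter> A) \<le> 3" using part by simp
  then consider "card (f \<inter> A) = 0" | "card (f \<inter> A) = 1" | "card (f \<inter> A) = 2" | "card (f \<inter> A) = 3"
    by linarith
  thus "(\<Sum>i \<in> f \<inter> A. face_angle I r i f) \<le> face_bound I A f"
    unfolding S_def[symmetric] using zero one two three by cases auto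
qed

lemma curvature_sum:
  fixes T :: "'n::finite set set"
  shows "(\<Sum>i\<in>A. curvature T I r $ i) =
    2 * pi * real (card A) - (\<Sum>f\<in>faces T. \<Sum>i \<in> f \<inter> A. face_angle I r i f)"
proof -
  have "(\<Sum>i\<in>A. \<Sum>f\<in>{f \<in> faces T. i \<in> f}. face_angle I r i f)
      = (\<Sum>f\<in>faces T. \<Sum>i\<in>{i \<in> A. i \<in> f}. face_angle I r i f)"
    by (rule sum.swap_restrict) auto
  also have "\<dots> = (\<Sum>f\<in>faces T. \<Sum>i \<in> f \<inter> A. face_angle I r i f)"
    by (intro sum.cong refl arg_cong2[where f = sum]) auto
  finally show ?thesis by (simp add: curvature_def sum_subtractf mult.commute)
qed

text \<open>
  Double counting of the pairs of an edge in \<open>A\<close> and a face containing it.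
\<close>

lemma twice_card_edges_within:
  fixes T :: "'n::finite set set"
  assumes T: "simplicial_complex T"
    and two: "\<And>e. e \<in> edges T \<Longrightarrow> card {f \<in> faces T. e \<subseteq> f} = 2"
  shows "2 * card {e \<in> edges T. e \<subseteq> A} = (\<Sum>f\<in>faces T. card (f \<inter> A) choose 2)"
proof -
  let ?E = "{e \<in> edges T. e \<subseteq> A}"
  have "2 * card ?E = (\<Sum>e\<in>?E. card {f \<in> faces T. e \<subseteq> f})" using two by simp
  also have "\<dots> = (\<Sum>f\<in>faces T. card {e \<in> ?E. e \<subseteq> f})"
    unfolding card_eq_sum by (rule sum.swap_restrict) auto
  also have "\<dots> = (\<Sum>f\<in>faces T. card (f \<inter> A) choose 2)"
  proof (rule sum.cong[OF refl])
    fix f assume f: "f \<in> faces T"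
    have "{e \<in> ?E. e \<subseteq> f} = {e. e \<subseteq> f \<inter> A \<and> card e = 2}"
    proof (intro equalityI subsetI)
      fix e assume e: "e \<in> {e. e \<subseteq> f \<inter> A \<and> card e = 2}"
      hence "e \<noteq> {}" by auto
      hence "e \<in> T" using simplicial_complex_subset[OF T, of f e] f e by (simp add: faces_def)
      thus "e \<in> {e \<in> ?E. e \<subseteq> f}" using e by (auto simp: edges_def)
    qed (auto simp: edges_def)
    thus "card {e \<in> ?E. e \<subseteq> f} = card (f \<inter> A) choose 2"
      using n_subsets[of "f \<inter> A" 2] by simp
  qed
  finally show ?thesis .
qed

text \<open>
  A link pair is the same as a face with exactly one vertex in \<open>A\<close>.
\<close>

lemma Lk_sum:
  fixes T :: "'n::finite set set"
  assumes T: "simplicial_complex T"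
  shows "(\<Sum>(e, v) \<in> Lk T A. g e) = (\<Sum>f\<in>faces T. if card (f \<inter> A) = 1 then g (f - A) else 0)"
proof -
  have "(\<Sum>(e, v) \<in> Lk T A. g e) = (\<Sum>f \<in> {f \<in> faces T. card (f \<inter> A) = 1}. g (f - A))"
  proof (rule sum.reindex_bij_witness[where j = "\<lambda>(e, v). insert v e"
        and i = "\<lambda>f. (f - A, the_elem (f \<inter> A))"])
    fix p assume "p \<in> Lk T A"
    then obtain e v where p: "p = (e, v)" "e \<inter> A = {}" "v \<in> A" "insert v e \<in> faces T"
      by (auto simp: Lk_def)
    have i: "insert v e \<inter> A = {v}" "insert v e - A = e" using p by auto
    show "(case p of (e, v) \<Rightarrow> insert v e) \<in> {f \<in> faces T. card (f \<inter> A) = 1}"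
      using p i by simp
    show "(\<lambda>f. (f - A, the_elem (f \<inter> A))) (case p of (e, v) \<Rightarrow> insert v e) = p"
      using p i by simp
    show "g ((case p of (e, v) \<Rightarrow> insert v e) - A) = (case p of (e, v) \<Rightarrow> g e)"
      using p i by simp
  next
    fix f assume f: "f \<in> {f \<in> faces T. card (f \<inter> A) = 1}"
    then obtain v where v: "f \<inter> A = {v}" by (auto simp: card_1_singleton_iff)
    have ins: "insert v (f - A) = f" using v by auto
    have c: "card f = 3" "f \<in> T" using f by (auto simp: faces_def)
    have "card (f - A) = 2" using c(1) card_Int_Diff[of f A] v by simp
    moreover from this have "f - A \<noteq> {}" by (metis card.empty zero_neq_numeral)
    hence "f - A \<in> T" by (intro simplicial_complex_subset[OF T c(2)]) auto
    ultimately show "(f - A, the_elem (f \<inter> A)) \<in> Lk T A"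
      using f v ins by (auto simp: Lk_def edges_def)
    show "(case (f - A, the_elem (f \<inter> A)) of (e, v) \<Rightarrow> insert v e) = f"
      using v ins by simp
  qed
  thus ?thesis by (simp add: sum.inter_filter)
qed

lemma euler_char_induced_subcomplex:
  assumes "vertices T = UNIV"
  shows "euler_char (induced_subcomplex T A) =
    int (card A) - int (card {e \<in> edges T. e \<subseteq> A}) + int (card {f \<in> faces T. f \<subseteq> A})"
proof -
  have "vertices (induced_subcomplex T A) = A"
    using assms by (auto simp: vertices_def induced_subcomplex_def)
  moreover have "edges (induced_subcomplex T A) = {e \<in> edges T. e \<subseteq> A}"
    "faces (induced_subcomplex T A) = {f \<in> faces T. f \<subseteq> A}"
    by (auto simp: edges_def faces_def induced_subcomplex_def)
  ultimately show ?thesis by (simp add: euler_char_def)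
qed

text \<open>
  Every edge in \<open>A\<close> contributes \<open>pi\<close> from each of its two faces, and every face in \<open>A\<close>
  contributes \<open>- 2 * pi\<close>, so \<open>2 * pi\<close> times the number of edges minus faces appears.
\<close>

lemma face_bound_sum:
  fixes T :: "'n::finite set set"
  assumes T: "simplicial_complex T" and V: "vertices T = UNIV"
    and two: "\<And>e. e \<in> edges T \<Longrightarrow> card {f \<in> faces T. e \<subseteq> f} = 2"
  shows "(\<Sum>f\<in>faces T. face_bound I A f) =
    2 * pi * real (card A) + (\<Sum>(e, v) \<in> Lk T A. pi - Lam (I e))
    - 2 * pi * of_int (euler_char (induced_subcomplex T A))"
proof -
  have within: "f \<subseteq> A \<longleftrightarrow> card (f \<inter> A) = 3" if "f \<in> faces T" for f
  proof
    assume "card (f \<inter> A) = 3"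
    hence "f \<inter> A = f" using that by (intro card_subset_eq) (auto simp: faces_def)
    thus "f \<subseteq> A" by blast
  next
    assume "f \<subseteq> A"
    thus "card (f \<inter> A) = 3" using that by (simp add: faces_def Int_absorb2)
  qed
  have "real (card {f \<in> faces T. f \<subseteq> A}) = (\<Sum>f \<in> {f \<in> faces T. card (f \<inter> A) = 3}. 1)"
    using within by (simp cong: conj_cong)
  also have "\<dots> = (\<Sum>f\<in>faces T. if card (f \<inter> A) = 3 then 1 else 0)"
    by (rule sum.inter_filter) simp
  finally have F: "(\<Sum>f\<in>faces T. if card (f \<inter> A) = 3 then 1 else 0)
      = real (card {f \<in> faces T. f \<subseteq> A})" by simp
  have E: "(\<Sum>f\<in>faces T. real (card (f \<inter> A) choose 2)) = 2 * real (card {e \<in> edges T. e \<subseteq> A})"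
    using twice_card_edges_within[OF T two, of A] by (simp flip: of_nat_sum)
  have "(\<Sum>f\<in>faces T. face_bound I A f)
      = pi * (\<Sum>f\<in>faces T. real (card (f \<inter> A) choose 2))
        - 2 * pi * (\<Sum>f\<in>faces T. if card (f \<inter> A) = 3 then 1 else 0)
        + (\<Sum>(e, v) \<in> Lk T A. pi - Lam (I e))"
    unfolding face_bound_def Lk_sum[OF T, where g = "\<lambda>e. pi - Lam (I e)"]
    by (simp only: sum.distrib sum_subtractf sum_distrib_left)
  thus ?thesis
    unfolding F E euler_char_induced_subcomplex[OF V] by (simp add: algebra_simps)
qed

section \<open>The space of curvatures\<close>

lemma sum_coordinates_eq_inner:
  fixes x :: "real ^ 'n::finite"
  shows "(\<Sum>i\<in>A. x $ i) = (\<chi> i. if i \<in> A then 1 else 0) \<bullet> x"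
proof -
  have "(\<chi> i. if i \<in> A then 1 else 0) \<bullet> x = (\<Sum>i\<in>UNIV. if i \<in> A then x $ i else 0)"
    unfolding inner_vec_def by (intro sum.cong) auto
  also have "\<dots> = (\<Sum>i\<in>A. x $ i)" by (simp add: sum.If_cases)
  finally show ?thesis by simp
qed

theorem theorem5p4:
  fixes M :: "'m topology"
    and T :: "'n::finite set set"
    and I :: "'n set \<Rightarrow> real"
  assumes "closed_surface M" and "connected_space M"
    and "triangulates T M"
    and "\<forall>e \<in> edges T. 0 \<le> I e"
  shows "let S = {x :: real ^ 'n. (\<Sum>i\<in>UNIV. x $ i) = 2 * pi * of_int (euler_char T)}
                   \<inter> (\<Inter>A \<in> {A. A \<noteq> {} \<and> A \<noteq> UNIV}. Y T I A)
         in curvature T I ` Omega T I \<subseteq> S \<and> convex S"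
  unfolding Let_def
proof (intro conjI)
  have T: "simplicial_complex T" and V: "vertices T = UNIV"
    using assms(3) by (simp_all add: triangulates_def)
  note total = face_bound_sum[OF T V edge_in_exactly_two_faces[OF assms(1,3)], where I = I]
  show "curvature T I ` Omega T I \<subseteq>
      {x. (\<Sum>i\<in>UNIV. x $ i) = 2 * pi * of_int (euler_char T)}
      \<inter> (\<Inter>A \<in> {A. A \<noteq> {} \<and> A \<noteq> UNIV}. Y T I A)"
  proof (intro image_subsetI IntI CollectI INT_I)
    fix r assume r: "r \<in> Omega T I"
    note bound = face_angle_sum_le_face_bound[OF T r _ assms(4)]
    \<comment> \<open>For the set of all vertices every face estimate is an equality: this is the Gauss-Bonnet
    formula.\<close>
    have "card (f \<inter> UNIV) = 3" if "f \<in> faces T" for f using that by (simp add: faces_def)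
    hence "(\<Sum>f\<in>faces T. \<Sum>i \<in> f \<inter> UNIV. face_angle I r i f) = (\<Sum>f\<in>faces T. face_bound I UNIV f)"
      by (intro sum.cong refl bound(3))
    moreover have "Lk T UNIV = {}" by (auto simp: Lk_def edges_def)
    moreover have "induced_subcomplex T UNIV = T" by (simp add: induced_subcomplex_def)
    ultimately show "(\<Sum>i\<in>UNIV. curvature T I r $ i) = 2 * pi * of_int (euler_char T)"
      using curvature_sum[of T I r UNIV] total[of UNIV] by simp
  next
    fix r and A :: "'n set" assume r: "r \<in> Omega T I" and "A \<in> {A. A \<noteq> {} \<and> A \<noteq> UNIV}"
    hence A: "A \<noteq> {}" "A \<noteq> UNIV" by auto
    note bound = face_angle_sum_le_face_bound[OF T r _ assms(4)]
    obtain f where f: "f \<in> faces T" "card (f \<inter> A) \<in> {1, 2}"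
      using mixed_face_exists[OF assms(1-3) A] by blast
    have "(\<Sum>f\<in>faces T. \<Sum>i \<in> f \<inter> A. face_angle I r i f) < (\<Sum>f\<in>faces T. face_bound I A f)"
    proof (rule sum_strict_mono_ex1)
      show "\<forall>f\<in>faces T. (\<Sum>i \<in> f \<inter> A. face_angle I r i f) \<le> face_bound I A f"
        using bound(1) by blast
      show "\<exists>f\<in>faces T. (\<Sum>i \<in> f \<inter> A. face_angle I r i f) < face_bound I A f"
        using bound(2)[OF f] f(1) by blast
    qed simp
    thus "curvature T I r \<in> Y T I A"
      using curvature_sum[of T I r A] total[of A] by (simp add: Y_def)
  qed
  show "convex ({x. (\<Sum>i\<in>UNIV. x $ i) = 2 * pi * of_int (euler_char T)}
      \<inter> (\<Inter>A \<in> {A. A \<noteq> {} \<and> A \<noteq> UNIV}. Y T I A))"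
    unfolding Y_def sum_coordinates_eq_inner
    by (intro convex_Int convex_INT convex_hyperplane convex_halfspace_gt)
qed

end
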